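(* (i) Let $n$ be any positive integer. Then, as rational functions in the variables $x_1,\ldots,x_{2n}$, $$\operatorname{per}[x_{j,k}-1]_{1\le j,k\le 2n}=(-1)^n\det[x_{j,k}-1]_{1\le j,k\le 2n}=S(x_1,\ldots,x_{2n}),$$ where $x_{j,k}=(x_j+x_k)/(x_j-x_k)$ if $j\neq k$ and $x_{j,j}=1$. (ii) Let $n>1$ be an integer, and let $\zeta$ be a primitive $n$th root of unity. Set $$c_{j,k}=\begin{cases}\dfrac{1+\zeta^{j-k}}{1-\zeta^{j-k}}&\text{if } j\neq k,\\ 1&\text{if } j=k.\end{cases}$$ If $n$ is even, then $$\operatorname{per}[c_{j,k}]_{1\le j,k\le n}=((n-1)!!)^2.$$ If $n$ is odd, then $$\operatorname{per}[c_{j,k}]_{1\le j,k\le n-1}=\frac{((n-1)!!)^2}{n}.$$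
   Context: The permanent of a matrix $[a_{j,k}]_{1\le j,k\le m}$ is $\operatorname{per}[a_{j,k}]_{1\le j,k\le m}=\sum_{\tau\in S_m}\prod_{j=1}^m a_{j,\tau(j)}$, where $S_m$ is the symmetric group on $\{1,\ldots,m\}$. For independent variables $x_1,\ldots,x_{2n}$, the rational function $S(x_1,\ldots,x_{2n})$ is defined as $\operatorname{per}[x_{j,k}]_{1\le j,k\le 2n}$ with $x_{j,k}$ as in part (i) of the claim; equivalently, $$S(x_1,\ldots,x_{2n})=\sum_{\tau\in S_{2n}}\ \prod_{\substack{1\le j\le 2n\\ \tau(j)\neq j}}\frac{x_j+x_{\tau(j)}}{x_j-x_{\tau(j)}},$$ where an empty product equals $1$. Here $m!!$ denotes the double factorial $m(m-2)(m-4)\cdots$ (ending in $1$ or $2$). Roots of unity are complex. *)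

theory Defs
  imports
    Complex_Main
    "HOL-Library.Poly_Mapping"
    "HOL-Computational_Algebra.Fraction_Field"
    "Jordan_Normal_Form.Determinant"
begin

text \<open>
  Rational functions over a coefficient field \<open>'a\<close> in the independent variables
  \<open>x\<^sub>0, x\<^sub>1, x\<^sub>2, \<dots>\<close>: a monomial is a finitely supported exponent map \<open>nat \<Rightarrow>\<^sub>0 nat\<close>, a polynomial
  a finitely supported map from monomials to coefficients (with convolution as product), and a
  rational function an element of the fraction field.  The rational functions in
  \<open>x\<^sub>1, \<dots>, x\<^sub>m\<close> form a subfield, so an identity between them can be stated here.
\<close>

type_synonym 'a ratfun = "((nat \<Rightarrow>\<^sub>0 nat) \<Rightarrow>\<^sub>0 'a) fract"

definition ratfun_var :: "nat \<Rightarrow> 'a::field_char_0 ratfun" where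
  "ratfun_var i = Fract (Poly_Mapping.single (Poly_Mapping.single i 1) 1) 1"

text \<open>
  \<open>indexed_mat m a\<close> is the matrix $[a_{j,k}]_{1\le j,k\le m}$.  The library's matrices are indexed
  from 0, whence the shift.
\<close>

definition indexed_mat :: "nat \<Rightarrow> (nat \<Rightarrow> nat \<Rightarrow> 'a) \<Rightarrow> 'a mat" where
  "indexed_mat m a = mat m m (\<lambda>(j, k). a (Suc j) (Suc k))"

definition per :: "'a::comm_ring_1 mat \<Rightarrow> 'a" where
  "per A = (if dim_row A = dim_col A
     then \<Sum>\<tau> \<in> {\<tau>. \<tau> permutes {0..<dim_row A}}. \<Prod>j = 0..<dim_row A. A $$ (j, \<tau> j)
     else 0)"

definition x_entry :: "(nat \<Rightarrow> 'a::field) \<Rightarrow> nat \<Rightarrow> nat \<Rightarrow> 'a" where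
  "x_entry x j k = (if j = k then 1 else (x j + x k) / (x j - x k))"

text \<open>\<open>S_fun n x\<close> is $S(x_1, \ldots, x_{2n})$.\<close>

definition S_fun :: "nat \<Rightarrow> (nat \<Rightarrow> 'a::field) \<Rightarrow> 'a" where
  "S_fun n x = per (indexed_mat (2 * n) (x_entry x))"

definition primitive_root_of_unity :: "nat \<Rightarrow> complex \<Rightarrow> bool" where
  "primitive_root_of_unity n \<zeta> \<longleftrightarrow> n > 0 \<and> \<zeta> ^ n = 1 \<and> (\<forall>k. 0 < k \<and> k < n \<longrightarrow> \<zeta> ^ k \<noteq> 1)"

definition c_entry :: "complex \<Rightarrow> nat \<Rightarrow> nat \<Rightarrow> complex" where
  "c_entry \<zeta> j k =
     (if j = k then 1
      else (1 + \<zeta> powi (int j - int k)) / (1 - \<zeta> powi (int j - int k)))"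

fun double_fact :: "nat \<Rightarrow> nat" where
  "double_fact 0 = 1"
| "double_fact (Suc 0) = 1"
| "double_fact (Suc (Suc m)) = Suc (Suc m) * double_fact m"

end

theory Submission
  imports Defs
begin

text \<open>
  Write \<open>a\<^sub>j\<^sub>k = (x\<^sub>j + x\<^sub>k) / (x\<^sub>j - x\<^sub>k)\<close> and consider the permanent \<open>P\<^sub>A(t)\<close> over a finite index set
  \<open>A\<close> of the matrix with entries \<open>t + a\<^sub>j\<^sub>k\<close> off and \<open>t + 1\<close> on the diagonal; its values at \<open>t = -1\<close>
  and \<open>t = 0\<close> are the two permanents of part (i).  Removing an index \<open>i\<close> from its cycle and using the
  addition formula \<open>a\<^sub>j\<^sub>i a\<^sub>i\<^sub>k = a\<^sub>j\<^sub>k (a\<^sub>i\<^sub>k - a\<^sub>i\<^sub>j) - 1\<close>, whose first term telescopes over the cycles, gives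
  with \<open>S = A - {i}\<close>
  \<open>P\<^sub>A = (t + 1) P\<^sub>S + (t\<^sup>2 - 1) P\<^sub>S' + (\<Sum>j\<in>S. (1 - a\<^sub>i\<^sub>j\<^sup>2) P\<^bsub>S - {j}\<^esub>)\<close>.
  For the determinant the last two terms change sign.  At \<open>t = -1\<close> only the sum remains, which yields
  \<open>per = (-1)\<^sup>n det\<close>.  A parity argument in \<open>t\<close> yields \<open>P\<^sub>A(0) = P\<^sub>A(-1)\<close> for even \<open>card A\<close>.

  For part (ii) take \<open>x\<^sub>j = \<zeta>\<^sup>-\<^sup>j\<close>.  The matrix whose determinant occurs in (i) is then a circulant
  of order \<open>n\<close> with the eigenvalues \<open>n + 1 - 2 r\<close> for \<open>1 \<le> r \<le> n\<close>, or, for odd \<open>n\<close>, its principal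
  minor of order \<open>n - 1\<close>, which is \<open>1 / n\<close> times the product of the nonzero eigenvalues.
\<close>

section \<open>Permanents under removal of an index\<close>

text \<open>\<open>e = 1\<close> gives permanents and \<open>e = -1\<close> determinants; as
  \<open>e * e = 1\<close> in both cases, one recursion covers them.\<close>

definition perm_char :: "'r::comm_ring_1 \<Rightarrow> ('i \<Rightarrow> 'i) \<Rightarrow> 'r" where
  "perm_char e p = (if evenperm p then 1 else e)"

definition twisted_per :: "'r::comm_ring_1 \<Rightarrow> 'i set \<Rightarrow> ('i \<Rightarrow> 'i \<Rightarrow> 'r) \<Rightarrow> 'r" where
  "twisted_per e A W = (\<Sum>p | p permutes A. perm_char e p * (\<Prod>j\<in>A. W j (p j)))"

lemma perm_char_transpose_comp:
  assumes "e * e = 1" "a \<noteq> b" "permutation p"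
  shows "perm_char e (transpose a b \<circ> p) = e * perm_char e p"
  using assms by (simp add: perm_char_def evenperm_comp permutation_swap_id evenperm_swap)

lemma twisted_per_empty [simp]: "twisted_per e {} W = 1"
  by (simp add: twisted_per_def perm_char_def)

text \<open>A permutation of the larger set fixes \<open>i\<close> or comes from one of
  \<open>S\<close> by inserting \<open>i\<close> into a cycle between \<open>j\<close> and
  \<open>p j\<close>; the extra transposition contributes the factor \<open>e\<close>.\<close>

lemma twisted_per_insert:
  assumes S: "finite S" "i \<notin> S" and e: "e * e = 1"
  shows "twisted_per e (insert i S) W = W i i * twisted_per e S W +
    e * (\<Sum>p | p permutes S. perm_char e p *
      (\<Sum>j\<in>S. W j i * W i (p j) * (\<Prod>l\<in>S - {j}. W l (p l))))"
proof -
  let ?f = "\<lambda>p. perm_char e p * (\<Prod>j\<in>insert i S. W j (p j))"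
  have fixed: "?f p = W i i * (perm_char e p * (\<Prod>j\<in>S. W j (p j)))" if "p permutes S" for p
    using S permutes_not_in[OF that \<open>i \<notin> S\<close>] by (simp add: mult_ac)
  have moved: "?f (transpose i (p j) \<circ> p) =
      e * (perm_char e p * (W j i * W i (p j) * (\<Prod>l\<in>S - {j}. W l (p l))))"
    if p: "p permutes S" and j: "j \<in> S" for p j
  proof -
    have pj: "p j \<in> S" using p j by (simp add: permutes_in_image)
    have pi: "p i = i" using p S by (simp add: permutes_not_in)
    have "perm_char e (transpose i (p j) \<circ> p) = e * perm_char e p"
      using e S pj permutation_permutes p by (intro perm_char_transpose_comp) auto
    moreover have "(\<Prod>l\<in>S. W l (transpose i (p j) (p l))) = W j i * (\<Prod>l\<in>S - {j}. W l (p l))"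
    proof -
      have "(\<Prod>l\<in>S - {j}. W l (transpose i (p j) (p l))) = (\<Prod>l\<in>S - {j}. W l (p l))"
      proof (rule prod.cong[OF refl])
        fix l assume l: "l \<in> S - {j}"
        have "p l \<noteq> i" using l p S permutes_in_image[OF p, of l] by auto
        moreover have "p l \<noteq> p j" using l permutes_inj[OF p] by (auto dest: injD)
        ultimately show "W l (transpose i (p j) (p l)) = W l (p l)"
          by (simp add: transpose_apply_other)
      qed
      then show ?thesis using S j by (simp add: prod.remove[of S j])
    qed
    ultimately show ?thesis using S pi by (simp add: mult_ac)
  qed
  have "twisted_per e (insert i S) W =
      (\<Sum>b\<in>insert i S. \<Sum>p | p permutes S. ?f (transpose i b \<circ> p))"
    unfolding twisted_per_def by (rule sum_over_permutations_insert[OF S])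
  also have "\<dots> = (\<Sum>p | p permutes S. ?f p) +
      (\<Sum>p | p permutes S. \<Sum>b\<in>S. ?f (transpose i b \<circ> p))"
    using S by (simp add: sum.swap[of _ S])
  \<comment> \<open>The image \<open>b\<close> of \<open>i\<close> is written as \<open>p j\<close>,
    so that \<open>j\<close> is the point now sent to \<open>i\<close>.\<close>
  also have "(\<Sum>p | p permutes S. \<Sum>b\<in>S. ?f (transpose i b \<circ> p)) =
      (\<Sum>p | p permutes S. \<Sum>j\<in>S. ?f (transpose i (p j) \<circ> p))"
  proof (rule sum.cong[OF refl])
    fix p assume "p \<in> {p. p permutes S}"
    then have p: "p permutes S" by simp
    show "(\<Sum>b\<in>S. ?f (transpose i b \<circ> p)) = (\<Sum>j\<in>S. ?f (transpose i (p j) \<circ> p))"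
      using sum.permute[OF p, of "\<lambda>b. ?f (transpose i b \<circ> p)"] by (simp add: o_def)
  qed
  also have "(\<Sum>p | p permutes S. ?f p) = W i i * twisted_per e S W"
    unfolding twisted_per_def sum_distrib_left by (intro sum.cong refl fixed) simp
  also have "(\<Sum>p | p permutes S. \<Sum>j\<in>S. ?f (transpose i (p j) \<circ> p)) =
      (\<Sum>p | p permutes S. \<Sum>j\<in>S.
        e * (perm_char e p * (W j i * W i (p j) * (\<Prod>l\<in>S - {j}. W l (p l)))))"
    by (intro sum.cong refl moved) auto
  finally show ?thesis by (simp add: sum_distrib_left)
qed

lemma permutes_fixing_iff:
  assumes "j \<in> S"
  shows "p permutes S \<and> p j = j \<longleftrightarrow> p permutes (S - {j})"
proof
  assume "p permutes S \<and> p j = j"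
  then show "p permutes (S - {j})" by (elim conjE) (rule permutes_superset[of p S], auto)
next
  assume p: "p permutes (S - {j})"
  then show "p permutes S \<and> p j = j"
    using permutes_subset[OF p, of S] permutes_not_in[OF p, of j] by auto
qed

text \<open>
  The summand \<^term>\<open>W j k * (g k - g j)\<close> of the addition formula disappears from the recursion:
  for a permutation \<open>p\<close> the differences \<^term>\<open>g (p j) - g j\<close> add up to 0.
\<close>

lemma twisted_per_recursion:
  assumes S: "finite S" "i \<notin> S" and e: "e * e = 1"
    and W: "\<And>j k. j \<in> S \<Longrightarrow> k \<in> S \<Longrightarrow>
      W j i * W i k = u + W j k * (g k - g j) + (if j = k then c j else 0)"
  shows "twisted_per e (insert i S) W = W i i * twisted_per e S W +
    e * (u * (\<Sum>p | p permutes S. perm_char e p * (\<Sum>j\<in>S. \<Prod>l\<in>S - {j}. W l (p l))) +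
         (\<Sum>j\<in>S. c j * twisted_per e (S - {j}) W))"
proof -
  have inner: "(\<Sum>j\<in>S. W j i * W i (p j) * (\<Prod>l\<in>S - {j}. W l (p l))) =
      u * (\<Sum>j\<in>S. \<Prod>l\<in>S - {j}. W l (p l)) +
      (\<Sum>j\<in>S. if p j = j then c j * (\<Prod>l\<in>S - {j}. W l (p l)) else 0)"
    if p: "p permutes S" for p
  proof -
    \<comment> \<open>The factor \<open>W j (p j)\<close> completes the product to all of
      \<open>S\<close>; the full product does not depend on \<open>j\<close> and leaves the sum of
      differences.\<close>
    have "(\<Sum>j\<in>S. W j i * W i (p j) * (\<Prod>l\<in>S - {j}. W l (p l))) =
      (\<Sum>j\<in>S. u * (\<Prod>l\<in>S - {j}. W l (p l)) + (\<Prod>l\<in>S. W l (p l)) * (g (p j) - g j) +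
        (if p j = j then c j * (\<Prod>l\<in>S - {j}. W l (p l)) else 0))"
    proof (rule sum.cong[OF refl])
      fix j assume j: "j \<in> S"
      then have "p j \<in> S" using p by (simp add: permutes_in_image)
      from W[OF j this] have "W j i * W i (p j) * (\<Prod>l\<in>S - {j}. W l (p l)) =
        (u + W j (p j) * (g (p j) - g j) + (if j = p j then c j else 0)) *
          (\<Prod>l\<in>S - {j}. W l (p l))"
        by (simp only:)
      then show "W j i * W i (p j) * (\<Prod>l\<in>S - {j}. W l (p l)) =
        u * (\<Prod>l\<in>S - {j}. W l (p l)) + (\<Prod>l\<in>S. W l (p l)) * (g (p j) - g j) +
        (if p j = j then c j * (\<Prod>l\<in>S - {j}. W l (p l)) else 0)"
        unfolding prod.remove[OF S(1) j] by (cases "p j = j") (simp_all add: distrib_left distrib_right mult_ac)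
    qed
    also have "\<dots> = u * (\<Sum>j\<in>S. \<Prod>l\<in>S - {j}. W l (p l)) +
        (\<Prod>l\<in>S. W l (p l)) * ((\<Sum>j\<in>S. g (p j)) - (\<Sum>j\<in>S. g j)) +
        (\<Sum>j\<in>S. if p j = j then c j * (\<Prod>l\<in>S - {j}. W l (p l)) else 0)"
      by (simp only: sum.distrib sum_subtractf flip: sum_distrib_left)
    also have "(\<Sum>j\<in>S. g (p j)) = (\<Sum>j\<in>S. g j)"
      using sum.permute[OF p, of g] by (simp add: o_def)
    finally show ?thesis by simp
  qed
  have finP: "finite {p. p permutes S}" using S by (simp add: finite_permutations)
  \<comment> \<open>The correction at \<open>j = k\<close> occurs only at fixed points of
    \<open>p\<close>, and a permutation of \<open>S\<close> fixing \<open>j\<close> is, as a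
    function, one of \<open>S - {j}\<close>.\<close>
  have fixing: "(\<Sum>p | p permutes S. perm_char e p *
        (if p j = j then c j * (\<Prod>l\<in>S - {j}. W l (p l)) else 0)) =
      c j * twisted_per e (S - {j}) W" if j: "j \<in> S" for j
  proof -
    have "{p. p permutes (S - {j})} = {p \<in> {p. p permutes S}. p j = j}"
      using permutes_fixing_iff[OF j] by auto
    then have "c j * twisted_per e (S - {j}) W = (\<Sum>p\<in>{p. p permutes S}.
        if p j = j then c j * (perm_char e p * (\<Prod>l\<in>S - {j}. W l (p l))) else 0)"
      unfolding twisted_per_def sum_distrib_left by (subst sum.inter_filter[OF finP, symmetric]) (simp only:)
    also have "\<dots> = (\<Sum>p | p permutes S. perm_char e p *
        (if p j = j then c j * (\<Prod>l\<in>S - {j}. W l (p l)) else 0))"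
      by (intro sum.cong refl) simp
    finally show ?thesis ..
  qed
  have "(\<Sum>p | p permutes S. perm_char e p *
      (\<Sum>j\<in>S. W j i * W i (p j) * (\<Prod>l\<in>S - {j}. W l (p l)))) =
    (\<Sum>p | p permutes S. u * (perm_char e p * (\<Sum>j\<in>S. \<Prod>l\<in>S - {j}. W l (p l))) +
      perm_char e p * (\<Sum>j\<in>S. if p j = j then c j * (\<Prod>l\<in>S - {j}. W l (p l)) else 0))"
    by (intro sum.cong refl) (simp only: mem_Collect_eq inner distrib_left mult.left_commute)
  also have "\<dots> = u * (\<Sum>p | p permutes S. perm_char e p * (\<Sum>j\<in>S. \<Prod>l\<in>S - {j}. W l (p l))) +
      (\<Sum>p | p permutes S. \<Sum>j\<in>S. perm_char e p *
        (if p j = j then c j * (\<Prod>l\<in>S - {j}. W l (p l)) else 0))"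
    by (simp only: sum.distrib sum_distrib_left)
  also have "(\<Sum>p | p permutes S. \<Sum>j\<in>S. perm_char e p *
        (if p j = j then c j * (\<Prod>l\<in>S - {j}. W l (p l)) else 0)) =
      (\<Sum>j\<in>S. c j * twisted_per e (S - {j}) W)"
    by (subst sum.swap) (intro sum.cong refl fixing)
  finally show ?thesis by (simp add: twisted_per_insert[OF S e])
qed

lemma perm_char_const_poly: "perm_char [:e:] p = [:perm_char e p:]"
  by (simp add: perm_char_def one_pCons)

lemma poly_twisted_per:
  "poly (twisted_per [:e:] A W) t = twisted_per e A (\<lambda>j k. poly (W j k) t)"
  by (simp add: twisted_per_def poly_sum poly_prod perm_char_const_poly)

lemma pderiv_sum: "pderiv (sum f A) = (\<Sum>a\<in>A. pderiv (f a))"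
  by (induct A rule: infinite_finite_induct) (simp_all add: pderiv_add)

text \<open>By the product rule, the one term of the recursion that is not a twisted permanent is
  the derivative of one.\<close>

lemma pderiv_twisted_per:
  fixes W :: "'i \<Rightarrow> 'i \<Rightarrow> 'a::field poly"
  assumes "\<And>j k. pderiv (W j k) = 1"
  shows "pderiv (twisted_per [:e:] A W) =
    (\<Sum>p | p permutes A. perm_char [:e:] p * (\<Sum>j\<in>A. \<Prod>l\<in>A - {j}. W l (p l)))"
  by (simp add: twisted_per_def pderiv_sum pderiv_smult pderiv_prod assms perm_char_const_poly)

section \<open>The matrix of quotients \<open>(x\<^sub>j + x\<^sub>k) / (x\<^sub>j - x\<^sub>k)\<close>\<close>

text \<open>The polynomial variable is the shift \<open>t\<close>; this makes differentiation and
  parity in \<open>t\<close> available.\<close>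

definition shifted_entry :: "(nat \<Rightarrow> 'a::field) \<Rightarrow> nat \<Rightarrow> nat \<Rightarrow> 'a poly" where
  "shifted_entry x j k = [:x_entry x j k, 1:]"

text \<open>This is the addition formula of the hyperbolic cotangent: substitute \<open>x\<^sub>j = exp (2 u\<^sub>j)\<close>.\<close>

lemma shifted_entry_addition:
  assumes "inj_on x (insert i S)" "i \<notin> S" "j \<in> S" "k \<in> S"
  shows "shifted_entry x j i * shifted_entry x i k =
    [:-1, 0, 1:] + shifted_entry x j k * ([:x_entry x i k:] - [:x_entry x i j:]) +
    (if j = k then [:1 - (x_entry x i j)\<^sup>2:] else 0)"
proof -
  have ne: "i \<noteq> j" "i \<noteq> k" using assms by auto
  have xne: "x i \<noteq> x j" "x i \<noteq> x k" and xjk: "j \<noteq> k \<Longrightarrow> x j \<noteq> x k"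
    using assms ne by (auto dest: inj_onD)
  have anti: "x_entry x j i = - x_entry x i j"
    using ne xne by (simp add: x_entry_def add.commute flip: minus_divide_right)
      (metis add.commute minus_diff_eq minus_divide_right)
  have add: "x_entry x j i * x_entry x i k =
      x_entry x j k * (x_entry x i k - x_entry x i j) - 1" if "j \<noteq> k"
  proof -
    have d: "x j - x i \<noteq> 0" "x i - x k \<noteq> 0" "x i - x j \<noteq> 0" "x j - x k \<noteq> 0"
      using xne xjk[OF that] by auto
    show ?thesis
      unfolding x_entry_def using ne that d by (simp add: divide_simps) (simp add: algebra_simps)
  qed
  \<comment> \<open>At \<open>j = k\<close> the product of the unshifted entries is
    \<open>- (x_entry x i j)^2\<close> instead of -1; the last summand is this difference.\<close>
  show ?thesis
  proof (cases "j = k")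
    case True
    then show ?thesis using anti by (simp add: shifted_entry_def power2_eq_square)
  next
    case False
    show ?thesis using add[OF False] anti False by (simp add: shifted_entry_def algebra_simps)
  qed
qed

definition shifted_per :: "'a::field \<Rightarrow> (nat \<Rightarrow> 'a) \<Rightarrow> nat set \<Rightarrow> 'a poly" where
  "shifted_per e x A = twisted_per [:e:] A (shifted_entry x)"

abbreviation reduced_per :: "'a::field \<Rightarrow> (nat \<Rightarrow> 'a) \<Rightarrow> nat set \<Rightarrow> 'a" where
  "reduced_per e x A \<equiv> twisted_per e A (\<lambda>j k. x_entry x j k - 1)"

lemma poly_shifted_per_minus_one: "poly (shifted_per e x A) (-1) = reduced_per e x A"
  by (simp add: shifted_per_def poly_twisted_per shifted_entry_def)

lemma poly_shifted_per_0: "poly (shifted_per e x A) 0 = twisted_per e A (x_entry x)"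
  by (simp add: shifted_per_def poly_twisted_per shifted_entry_def)

lemma shifted_per_insert:
  assumes S: "finite S" "i \<notin> S" and e: "e * e = 1" and x: "inj_on x (insert i S)"
  shows "shifted_per e x (insert i S) = [:1, 1:] * shifted_per e x S +
    [:e:] * ([:-1, 0, 1:] * pderiv (shifted_per e x S) +
      (\<Sum>j\<in>S. [:1 - (x_entry x i j)\<^sup>2:] * shifted_per e x (S - {j})))"
proof -
  have "pderiv (shifted_entry x j k) = 1" for j k
    by (simp add: shifted_entry_def pderiv_pCons)
  moreover have "shifted_entry x i i = [:1, 1:]"
    by (simp add: shifted_entry_def x_entry_def)
  moreover have "[:e:] * [:e:] = 1" using e by (simp add: one_pCons)
  note twisted_per_recursion[OF S this shifted_entry_addition[OF x S(2)]]
  ultimately show ?thesis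
    by (simp only: shifted_per_def pderiv_twisted_per)
qed

section \<open>Permanent and determinant at \<open>t = -1\<close>\<close>

lemma reduced_per_insert:
  assumes S: "finite S" "i \<notin> S" and e: "e * e = 1" and x: "inj_on x (insert i S)"
  shows "reduced_per e x (insert i S) =
    e * (\<Sum>j\<in>S. (1 - (x_entry x i j)\<^sup>2) * reduced_per e x (S - {j}))"
  using arg_cong[OF shifted_per_insert[OF assms], of "\<lambda>p. poly p (-1)"]
  by (simp add: poly_shifted_per_minus_one poly_sum)

text \<open>The recursion at \<open>t = -1\<close> removes two indices at a time, and for a single
  index its sum is empty.\<close>

lemma reduced_per_odd:
  assumes "finite A" "odd (card A)" "inj_on x A" "e * e = 1"
  shows "reduced_per e x A = 0"
  using assms
proof (induction A rule: finite_psubset_induct)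
  case (psubset A)
  then obtain i where i: "i \<in> A" by fastforce
  define S where "S = A - {i}"
  have A: "A = insert i S" "i \<notin> S" "finite S" using i psubset.hyps by (auto simp: S_def)
  have "reduced_per e x (S - {j}) = 0" if j: "j \<in> S" for j
  proof (rule psubset.IH)
    show "odd (card (S - {j}))" using psubset.prems(1) A j
      by (cases "card S") auto
    show "inj_on x (S - {j})" using psubset.prems(2) A by (auto intro: inj_on_diff)
  qed (use A j psubset.prems in auto)
  then show ?case using reduced_per_insert[of S i e x] A psubset.prems by simp
qed

text \<open>Each removed pair of indices contributes one factor \<open>e\<close>, hence one sign
  between \<open>e = 1\<close> and \<open>e = -1\<close>.\<close>

lemma reduced_per_minus_one:
  assumes "finite A" "even (card A)" "inj_on x A"
  shows "reduced_per 1 x A = (-1) ^ (card A div 2) * reduced_per (-1) x A"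
  using assms
proof (induction A rule: finite_psubset_induct)
  case (psubset A)
  show ?case
  proof (cases "A = {}")
    case False
    then obtain i where i: "i \<in> A" by auto
    define S where "S = A - {i}"
    have A: "A = insert i S" "i \<notin> S" "finite S" using i psubset.hyps by (auto simp: S_def)
    have "reduced_per 1 x (S - {j}) = - ((-1) ^ (card A div 2) * reduced_per (-1) x (S - {j}))"
      if j: "j \<in> S" for j
    proof -
      have c: "card A = Suc (Suc (card (S - {j})))" using A j
        by (metis card.remove card_insert_disjoint)
      then have "reduced_per 1 x (S - {j}) =
          (-1) ^ (card (S - {j}) div 2) * reduced_per (-1) x (S - {j})"
        using psubset.prems A j by (intro psubset.IH) (auto intro: inj_on_diff)
      then show ?thesis using c by simp
    qed
    then show ?thesis
      using reduced_per_insert[of S i 1 x] reduced_per_insert[of S i "-1" x] A psubset.prems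
      by (simp add: sum_negf sum_distrib_left mult_ac)
  qed simp
qed

section \<open>Parity in the shift \<open>t\<close>\<close>

lemma smult_sum_right: "smult c (sum f A) = (\<Sum>i\<in>A. smult c (f i))"
  by (induction A rule: infinite_finite_induct) (simp_all add: smult_add_right)

text \<open>
  The invariant behind \<open>per = S\<close>: as a polynomial in the shift \<open>t\<close>, the permanent is its value
  at \<open>t = -1\<close> plus \<open>1 + t\<close> times a polynomial \<open>q\<close> of known parity.  For even order \<open>q\<close> is odd, so the
  values at \<open>t = 0\<close> and at \<open>t = -1\<close> agree.
\<close>

lemma shifted_per_parity:
  assumes "finite A" "inj_on x A"
  shows "\<exists>q. shifted_per 1 x A = [:reduced_per 1 x A:] + [:1, 1:] * q \<and>
    pcompose q [:0, -1:] = smult ((-1) ^ Suc (card A)) q"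
  using assms
proof (induction A rule: finite_psubset_induct)
  case (psubset A)
  show ?case
  proof (cases "A = {}")
    case True
    then show ?thesis by (intro exI[of _ 0]) (simp add: shifted_per_def one_pCons)
  next
    case False
    then obtain i where i: "i \<in> A" by auto
    define S where "S = A - {i}"
    have A: "A = insert i S" "i \<notin> S" "finite S" using i psubset.hyps by (auto simp: S_def)
    have cA: "card A = Suc (card S)" using A by simp
    have injS: "inj_on x S" using psubset.prems A by auto
    let ?H = "reduced_per 1 x" and ?c = "\<lambda>j. 1 - (x_entry x i j)\<^sup>2"
    obtain q where q: "shifted_per 1 x S = [:?H S:] + [:1, 1:] * q"
      "pcompose q [:0, -1:] = smult ((-1) ^ Suc (card S)) q"
      using psubset.IH[of S] A injS by auto
    have "\<forall>j\<in>S. \<exists>r. shifted_per 1 x (S - {j}) = [:?H (S - {j}):] + [:1, 1:] * r \<and>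
        pcompose r [:0, -1:] = smult ((-1) ^ Suc (card (S - {j}))) r"
      using A injS by (intro ballI psubset.IH) (auto intro: inj_on_diff)
    then obtain r where r: "\<And>j. j \<in> S \<Longrightarrow> shifted_per 1 x (S - {j}) =
        [:?H (S - {j}):] + [:1, 1:] * r j"
      "\<And>j. j \<in> S \<Longrightarrow> pcompose (r j) [:0, -1:] = smult ((-1) ^ Suc (card (S - {j}))) (r j)"
      by metis
    \<comment> \<open>Result of inserting the decompositions into the recursion and dividing by
      \<open>1 + t\<close>. Of \<open>2 t q\<close>, the part \<open>(1 + t) q\<close> comes from
      the first term and \<open>(t - 1) q\<close> from the derivative.\<close>
    define q' where
      "q' = [:?H S:] + [:0, 2:] * q + [:-1, 0, 1:] * pderiv q + (\<Sum>j\<in>S. [:?c j:] * r j)"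
    have HA: "?H A = (\<Sum>j\<in>S. ?c j * ?H (S - {j}))"
      using reduced_per_insert[of S i 1 x] A psubset.prems by simp
    have sum_poly: "(\<Sum>j\<in>S. [:?c j:] * shifted_per 1 x (S - {j})) =
        [:?H A:] + [:1, 1:] * (\<Sum>j\<in>S. [:?c j:] * r j)"
    proof -
      have const_sum: "(\<Sum>j\<in>S. [:f j:]) = [:sum f S:]" for f :: "nat \<Rightarrow> 'a"
        by (induction S rule: infinite_finite_induct) simp_all
      have "[:?H A:] = (\<Sum>j\<in>S. [:?c j:] * [:?H (S - {j}):])"
        unfolding HA const_sum[symmetric] by (simp add: mult.commute)
      then show ?thesis
        by (simp only: sum_distrib_left flip: sum.distrib)
          (intro sum.cong refl, simp only: r(1) distrib_left mult.left_commute)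
    qed
    have "shifted_per 1 x A = [:?H A:] + [:1, 1:] * q'"
    proof -
      have dq: "pderiv (shifted_per 1 x S) = q + [:1, 1:] * pderiv q"
        unfolding q(1) by (simp only: pderiv_add pderiv_mult pderiv_pCons) simp
      have t: "[:0, 2:] = [:1, 1:] + [:-1, 1::'a:]" "[:-1, 0, 1::'a:] = [:1, 1:] * [:-1, 1:]"
        by simp_all
      have "shifted_per 1 x A = [:1, 1:] * ([:?H S:] + [:1, 1:] * q) +
          [:1:] * ([:-1, 0, 1:] * (q + [:1, 1:] * pderiv q) +
            ([:?H A:] + [:1, 1:] * (\<Sum>j\<in>S. [:?c j:] * r j)))"
        using shifted_per_insert[of S i 1 x] A psubset.prems sum_poly q(1) dq by simp
      moreover have "T * (h + T * q) + [:1:] * (T * M * (q + T * d) + (H + T * R)) =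
          H + T * (h + (T + M) * q + T * M * d + R)" for T M h d H R :: "'a poly"
        by (simp add: algebra_simps)
      ultimately show ?thesis
        unfolding q'_def t by (simp only:)
    qed
    \<comment> \<open>Multiplication by \<open>2 t\<close> and differentiation each reverse the
      parity of \<open>q\<close>; each \<open>r j\<close> belongs to an order smaller by two than
      that of \<open>A\<close>, so it has the desired parity already.\<close>
    moreover have "pcompose q' [:0, -1:] = smult ((-1) ^ Suc (card A)) q'"
    proof -
      define s :: 'a where "s = (-1) ^ Suc (card A)"
      have sS: "(-1) ^ Suc (card S) = - s" by (simp add: s_def cA)
      have "- pcompose (pderiv q) [:0, -1:] = - smult s (pderiv q)"
        using arg_cong[OF q(2), of pderiv] unfolding sS
        by (simp add: pderiv_pcompose pderiv_smult pderiv_minus pderiv_pCons)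
      then have dq: "pcompose (pderiv q) [:0, -1:] = smult s (pderiv q)"
        by (simp only: neg_equal_iff_equal)
      have cr: "pcompose (r j) [:0, -1:] = smult s (r j)" if "j \<in> S" for j
      proof -
        have "card S = Suc (card (S - {j}))" using A that by (metis card.remove)
        then show ?thesis using r(2)[OF that] by (simp add: s_def cA)
      qed
      \<comment> \<open>A constant is even, which settles \<open>s = 1\<close>; for
        \<open>s = -1\<close> the order of \<open>S\<close> is odd and the constant is 0.\<close>
      have "[:?H S:] = smult s [:?H S:]"
        using reduced_per_odd[of S x 1] A injS cA by (cases "even (card A)") (auto simp: s_def)
      moreover have "pcompose ([:0, 2:] * q) [:0, -1:] = smult s ([:0, 2:] * q)"
      proof -
        have "pcompose [:0, 2:] [:0, -1:] = - [:0, 2::'a:]" by (simp add: pcompose_pCons)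
        then show ?thesis
          by (simp only: pcompose_mult q(2) sS smult_minus_left mult_smult_right minus_mult_minus)
      qed
      moreover have "pcompose ([:-1, 0, 1:] * pderiv q) [:0, -1:] = smult s ([:-1, 0, 1:] * pderiv q)"
      proof -
        have "pcompose [:-1, 0, 1:] [:0, -1:] = [:-1, 0, 1::'a:]" by (simp add: pcompose_pCons)
        then show ?thesis by (simp only: pcompose_mult dq mult_smult_right)
      qed
      moreover have "pcompose (\<Sum>j\<in>S. [:?c j:] * r j) [:0, -1:] = smult s (\<Sum>j\<in>S. [:?c j:] * r j)"
        unfolding pcompose_sum smult_sum_right
        by (intro sum.cong refl) (simp only: pcompose_mult pcompose_const cr mult_smult_right)
      ultimately show ?thesis
        unfolding q'_def pcompose_add pcompose_const smult_add_right s_def[symmetric] by (simp only:)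
    qed
    ultimately show ?thesis by blast
  qed
qed

lemma twisted_per_x_entry_even:
  assumes "finite A" "even (card A)" "inj_on x A" and two: "(2::'a::field) \<noteq> 0"
  shows "twisted_per 1 A (x_entry x) = reduced_per 1 (x :: nat \<Rightarrow> 'a) A"
proof -
  obtain q where q: "shifted_per 1 x A = [:reduced_per 1 x A:] + [:1, 1:] * q"
    "pcompose q [:0, -1:] = smult ((-1) ^ Suc (card A)) q"
    using shifted_per_parity assms by blast
  have "poly q 0 = - poly q 0"
    using arg_cong[OF q(2), of "\<lambda>p. poly p 0"] assms(2) by (simp add: poly_pcompose)
  then have "2 * poly q 0 = 0" by (simp only: eq_neg_iff_add_eq_0 mult_2)
  then show ?thesis
    using two arg_cong[OF q(1), of "\<lambda>p. poly p 0"] by (simp add: poly_shifted_per_0)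
qed

section \<open>Permanents and determinants of indexed matrices\<close>

lemma per_indexed_mat:
  "per (indexed_mat m w) = twisted_per 1 {0..<m} (\<lambda>j k. w (Suc j) (Suc k))"
proof -
  have "(\<Prod>j = 0..<m. indexed_mat m w $$ (j, p j)) = (\<Prod>j = 0..<m. w (Suc j) (Suc (p j)))"
    if "p permutes {0..<m}" for p
    using permutes_in_image[OF that] by (intro prod.cong) (auto simp: indexed_mat_def)
  then show ?thesis
    by (simp add: per_def twisted_per_def perm_char_def indexed_mat_def)
qed

lemma perm_char_minus_one: "perm_char (-1) p = of_int (sign p)"
  by (simp add: perm_char_def sign_def)

lemma det_indexed_mat:
  "det (indexed_mat m w) = twisted_per (-1) {0..<m} (\<lambda>j k. w (Suc j) (Suc k))"
proof -
  have "(\<Prod>j = 0..<m. indexed_mat m w $$ (j, p j)) = (\<Prod>j = 0..<m. w (Suc j) (Suc (p j)))"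
    if "p permutes {0..<m}" for p
    using permutes_in_image[OF that] by (intro prod.cong) (auto simp: indexed_mat_def)
  then show ?thesis
    by (simp add: det_def twisted_per_def perm_char_minus_one indexed_mat_def)
qed

lemma x_entry_Suc: "x_entry x (Suc j) (Suc k) = x_entry (\<lambda>l. x (Suc l)) j k"
  by (simp add: x_entry_def)

text \<open>Stated for distinct values in any field of characteristic other than 2, because it
  serves both the variables of the rational functions and the powers of a root of unity.\<close>

lemma per_x_entry:
  fixes x :: "nat \<Rightarrow> 'a::field"
  assumes x: "inj_on x {1..2 * n}" and two: "(2::'a) \<noteq> 0"
  shows "per (indexed_mat (2 * n) (\<lambda>j k. x_entry x j k - 1)) =
      (-1) ^ n * det (indexed_mat (2 * n) (\<lambda>j k. x_entry x j k - 1))"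
    and "per (indexed_mat (2 * n) (x_entry x)) =
      (-1) ^ n * det (indexed_mat (2 * n) (\<lambda>j k. x_entry x j k - 1))"
proof -
  let ?x = "\<lambda>l. x (Suc l)"
  have "inj_on ?x {0..<2 * n}"
    using inj_onD[OF x, of "Suc a" "Suc b" for a b] by (intro inj_onI) simp
  then have x': "reduced_per 1 ?x {0..<2 * n} = (-1) ^ n * reduced_per (-1) ?x {0..<2 * n}"
    "twisted_per 1 {0..<2 * n} (x_entry ?x) = reduced_per 1 ?x {0..<2 * n}"
    using reduced_per_minus_one[of "{0..<2 * n}" ?x]
      twisted_per_x_entry_even[OF _ _ _ two, of "{0..<2 * n}" ?x] by simp_all
  show "per (indexed_mat (2 * n) (\<lambda>j k. x_entry x j k - 1)) =
      (-1) ^ n * det (indexed_mat (2 * n) (\<lambda>j k. x_entry x j k - 1))"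
    unfolding per_indexed_mat det_indexed_mat x_entry_Suc by (rule x'(1))
  show "per (indexed_mat (2 * n) (x_entry x)) =
      (-1) ^ n * det (indexed_mat (2 * n) (\<lambda>j k. x_entry x j k - 1))"
    unfolding per_indexed_mat det_indexed_mat x_entry_Suc x' ..
qed

section \<open>The variables in the field of rational functions\<close>

lemma single_one_eq_iff:
  "Poly_Mapping.single k (1 :: 'b::zero_neq_one) = Poly_Mapping.single k' 1 \<longleftrightarrow> k = k'"
  by (metis lookup_single_eq lookup_single_not_eq zero_neq_one)

lemma ratfun_var_eq_iff: "(ratfun_var i :: 'a::field_char_0 ratfun) = ratfun_var j \<longleftrightarrow> i = j"
  unfolding ratfun_var_def by (subst eq_fract) (simp_all add: single_one_eq_iff del: One_nat_def)

lemma ratfun_two_neq_0: "(2 :: 'a::field_char_0 ratfun) \<noteq> 0"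
proof -
  have "(2 :: 'a ratfun) = of_nat 2" by simp
  also have "\<dots> = Fract (of_nat 2) 1" by (rule of_nat_fract)
  also have "\<dots> \<noteq> Fract 0 1" by (subst eq_fract) simp_all
  finally show ?thesis unfolding Zero_fract_def .
qed

section \<open>Roots of unity\<close>

lemma prim_root_nonzero: "primitive_root_of_unity n \<zeta> \<Longrightarrow> \<zeta> \<noteq> 0"
  by (auto simp: primitive_root_of_unity_def zero_power)

lemma prim_root_inj:
  assumes "primitive_root_of_unity n \<zeta>"
  shows "inj_on (\<lambda>k. \<zeta> ^ k) {..<n}"
proof (rule linorder_inj_onI')
  fix i j assume ij: "i \<in> {..<n}" "j \<in> {..<n}" "i < j"
  show "\<zeta> ^ i \<noteq> \<zeta> ^ j"
  proof
    assume "\<zeta> ^ i = \<zeta> ^ j"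
    also have "\<zeta> ^ j = \<zeta> ^ i * \<zeta> ^ (j - i)"
      using ij by (simp flip: power_add)
    finally have "\<zeta> ^ (j - i) = 1"
      using prim_root_nonzero[OF assms] by simp
    moreover have "0 < j - i" "j - i < n" using ij by auto
    ultimately show False
      using assms unfolding primitive_root_of_unity_def by blast
  qed
qed

lemma prim_root_ratio_eq_1_iff:
  assumes "primitive_root_of_unity n \<zeta>" "j < n" "k < n"
  shows "\<zeta> ^ k * inverse \<zeta> ^ j = 1 \<longleftrightarrow> k = j"
proof -
  have "\<zeta> ^ k * inverse \<zeta> ^ j = 1 \<longleftrightarrow> \<zeta> ^ k = \<zeta> ^ j"
    using prim_root_nonzero[OF assms(1)] by (simp add: field_simps)
  then show ?thesis
    using inj_on_eq_iff[OF prim_root_inj[OF assms(1)], of k j] assms by simp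
qed

lemma prim_root_orthogonality:
  assumes "primitive_root_of_unity n \<zeta>" "j < n" "k < n"
  shows "(\<Sum>r<n. (\<zeta> ^ k * inverse \<zeta> ^ j) ^ r) = (if k = j then of_nat n else 0)"
proof (cases "k = j")
  case True
  then show ?thesis
    using prim_root_ratio_eq_1_iff[OF assms] by simp
next
  case False
  have "\<zeta> ^ n = 1" using assms by (simp add: primitive_root_of_unity_def)
  moreover have "(\<zeta> ^ k * inverse \<zeta> ^ j) ^ n = (\<zeta> ^ n) ^ k * inverse (\<zeta> ^ n) ^ j"
    by (simp add: power_mult_distrib power_inverse mult.commute flip: power_mult)
  ultimately have "(\<zeta> ^ k * inverse \<zeta> ^ j) ^ n = 1" by simp
  then show ?thesis
    using prim_root_ratio_eq_1_iff[OF assms] False by (simp add: geometric_sum)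
qed

section \<open>Eigenvalues of the circulant\<close>

definition root_entry :: "complex \<Rightarrow> nat \<Rightarrow> nat \<Rightarrow> complex" where
  "root_entry \<zeta> j k = x_entry (\<lambda>l. inverse \<zeta> ^ l) j k - 1"

lemma root_entry_diag [simp]: "root_entry \<zeta> j j = 0"
  by (simp add: root_entry_def x_entry_def)

text \<open>Off the diagonal the entry is \<open>2 x_k / (x_j - x_k)\<close>, that is
  \<open>2 / (u - 1)\<close> with \<open>u = x_j / x_k\<close>, where \<open>x_l\<close> is
  \<open>inverse \<zeta> ^ l\<close>.\<close>

lemma root_entry_eq:
  assumes "primitive_root_of_unity n \<zeta>" "j < n" "k < n" "j \<noteq> k"
  shows "root_entry \<zeta> j k * (\<zeta> ^ k * inverse \<zeta> ^ j - 1) = 2"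
proof -
  have z: "\<zeta> \<noteq> 0" using prim_root_nonzero assms by blast
  have "\<zeta> ^ k \<noteq> \<zeta> ^ j"
    using inj_on_eq_iff[OF prim_root_inj[OF assms(1)], of k j] assms by simp
  then have "inverse \<zeta> ^ j \<noteq> inverse \<zeta> ^ k"
    by (metis power_inverse inverse_eq_iff_eq)
  then have "root_entry \<zeta> j k * (inverse \<zeta> ^ j - inverse \<zeta> ^ k) = 2 * inverse \<zeta> ^ k"
    using assms(4) by (simp add: root_entry_def x_entry_def left_diff_distrib)
  then have "\<zeta> ^ k * (root_entry \<zeta> j k * (inverse \<zeta> ^ j - inverse \<zeta> ^ k)) =
      2 * (\<zeta> ^ k * inverse \<zeta> ^ k)"
    by (simp only: mult.left_commute)
  then have "root_entry \<zeta> j k * (\<zeta> ^ k * inverse \<zeta> ^ j - \<zeta> ^ k * inverse \<zeta> ^ k) =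
      2 * (\<zeta> ^ k * inverse \<zeta> ^ k)"
    by (simp only: right_diff_distrib mult.left_commute)
  moreover have "\<zeta> ^ k * inverse \<zeta> ^ k = 1" using z by (simp add: power_inverse)
  ultimately show ?thesis by (simp only: mult_1_right)
qed

text \<open>The linear pattern runs over \<open>1..n\<close>; the exponents matter modulo
  \<open>n\<close>, so index 0 carries the value of the pattern at \<open>r = n\<close>.\<close>

definition root_eigenvalue :: "nat \<Rightarrow> nat \<Rightarrow> complex" where
  "root_eigenvalue n r = (if r = 0 then 1 - of_nat n else of_nat n + 1 - 2 * of_nat r)"

text \<open>
  The difference of consecutive eigenvalue sums carries the factor \<open>\<zeta>\<^sup>k\<^sup>-\<^sup>j - 1\<close>, which clears the
  denominators of the entries; the vanishing trace then fixes the remaining constant.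
\<close>

lemma root_entry_eigenvalue:
  assumes prim: "primitive_root_of_unity n \<zeta>" and "j < n" "r < n"
  shows "(\<Sum>k<n. root_entry \<zeta> j k * (\<zeta> ^ k * inverse \<zeta> ^ j) ^ r) = root_eigenvalue n r"
proof -
  define u where "u k = \<zeta> ^ k * inverse \<zeta> ^ j" for k
  define d where "d r = (\<Sum>k<n. root_entry \<zeta> j k * u k ^ r)" for r
  have z: "\<zeta> \<noteq> 0" using prim_root_nonzero prim by blast
  have uj: "u j = 1" using z by (simp add: u_def power_inverse)
  have sum_u: "(\<Sum>k<n. u k ^ r) = (if r = 0 then of_nat n else 0)" if "r < n" for r
  proof -
    have "(\<Sum>k<n. u k ^ r) = inverse \<zeta> ^ (j * r) * (\<Sum>k<n. (\<zeta> ^ r * inverse \<zeta> ^ 0) ^ k)"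
      by (simp add: u_def power_mult_distrib sum_distrib_left mult.commute flip: power_mult)
    also have "\<dots> = (if r = 0 then of_nat n else 0)"
      using prim_root_orthogonality[OF prim, of 0 r] that \<open>j < n\<close> by simp
    finally show ?thesis .
  qed
  have step: "d (Suc r) = d r + 2 * (if r = 0 then of_nat n else 0) - 2" if "r < n" for r
  proof -
    have "d (Suc r) - d r = (\<Sum>k<n. root_entry \<zeta> j k * (u k - 1) * u k ^ r)"
      unfolding d_def sum_subtractf[symmetric] by (intro sum.cong refl) (simp add: algebra_simps)
    \<comment> \<open>At \<open>k = j\<close> the term is 0 while \<open>2 * u j ^ r = 2\<close>,
      hence the correction.\<close>
    also have "\<dots> = (\<Sum>k<n. 2 * u k ^ r - (if k = j then 2 else 0))"
    proof (rule sum.cong[OF refl])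
      fix k assume "k \<in> {..<n}"
      then show "root_entry \<zeta> j k * (u k - 1) * u k ^ r = 2 * u k ^ r - (if k = j then 2 else 0)"
        using root_entry_eq[OF prim \<open>j < n\<close>, of k] uj by (auto simp: u_def)
    qed
    also have "\<dots> = 2 * (if r = 0 then of_nat n else 0) - 2"
      using \<open>j < n\<close> by (simp only: sum_subtractf sum_distrib_left[symmetric] sum_u[OF that]) simp
    finally show ?thesis by (simp add: algebra_simps)
  qed
  have closed: "d r = d 0 + (if r = 0 then 0 else 2 * of_nat n - 2 * of_nat r)" if "r < n" for r
    using that
  proof (induction r)
    case (Suc r)
    then show ?case using step[of r] by (simp split: if_splits)
  qed simp
  \<comment> \<open>Orthogonality reduces the sum of all eigenvalues to a multiple of the diagonal
    entry, which is 0.\<close>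
  have "(\<Sum>r<n. d r) = (\<Sum>k<n. root_entry \<zeta> j k * (\<Sum>r<n. u k ^ r))"
    unfolding d_def by (subst sum.swap) (simp add: sum_distrib_left)
  also have "\<dots> = (\<Sum>k<n. 0)"
    using prim_root_orthogonality[OF prim \<open>j < n\<close>] by (intro sum.cong refl) (simp add: u_def)
  finally have sum_d: "(\<Sum>r<n. d r) = 0" by simp
  \<comment> \<open>An arithmetic series; \<open>m\<close> and \<open>N\<close> are kept apart so
    that the induction varies only the upper limit.\<close>
  have shift: "(\<Sum>r<m. if r = 0 then 0 else 2 * of_nat (N::nat) - 2 * of_nat r :: complex) =
      (of_nat m - 1) * (2 * of_nat N - of_nat m)" if "m > 0" for m N
    using that
  proof (induction m)
    case (Suc m)
    then show ?case by (cases "m = 0") (simp_all add: algebra_simps)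
  qed simp
  have "(\<Sum>r<n. d r) = (\<Sum>r<n. d 0 + (if r = 0 then 0 else 2 * of_nat n - 2 * of_nat r))"
    by (intro sum.cong refl closed) simp
  also have "\<dots> = of_nat n * d 0 + (of_nat n - 1) * of_nat n"
    using shift[of n n] \<open>j < n\<close> by (simp add: sum.distrib)
  finally have "(\<Sum>r<n. d r) = of_nat n * d 0 + (of_nat n - 1) * of_nat n" .
  then have "of_nat n * (d 0 + (of_nat n - 1)) = 0"
    using sum_d by (simp add: algebra_simps)
  then have "d 0 + (of_nat n - 1) = 0"
    using \<open>j < n\<close> by (simp only: mult_eq_0_iff of_nat_eq_0_iff) simp
  then have "d 0 = 1 - of_nat n"
    by (simp add: algebra_simps)
  then show ?thesis
    using closed[OF \<open>r < n\<close>] unfolding d_def u_def root_eigenvalue_def by auto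
qed

text \<open>The index \<open>r = (n + 1) / 2\<close> of the zero eigenvalue exists only for odd \<open>n\<close>.\<close>

definition nonzero_eigenvalue :: "nat \<Rightarrow> nat \<Rightarrow> complex" where
  "nonzero_eigenvalue n r = (if 2 * r = n + 1 then 1 else root_eigenvalue n r)"

lemma nonzero_eigenvalue_neq_0: "n > 1 \<Longrightarrow> nonzero_eigenvalue n r \<noteq> 0"
proof -
  assume "n > 1"
  have "root_eigenvalue n r \<noteq> 0" if "2 * r \<noteq> n + 1"
  proof
    assume "root_eigenvalue n r = 0"
    then have "of_nat n + 1 = (2 * of_nat r :: complex) \<or> 1 = (of_nat n :: complex)"
      by (auto simp: root_eigenvalue_def split: if_splits)
    then have "of_nat (n + 1) = (of_nat (2 * r) :: complex) \<or> of_nat 1 = (of_nat n :: complex)"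
      by (simp only: of_nat_add of_nat_mult of_nat_1 of_nat_numeral)
    then show False using that \<open>n > 1\<close> by (simp only: of_nat_eq_iff) auto
  qed
  then show ?thesis by (simp add: nonzero_eigenvalue_def)
qed

text \<open>Passing from \<open>n\<close> to \<open>n + 2\<close> shifts the factors by one index
  and adds the outer pair \<open>n + 1\<close> and \<open>- (n + 1)\<close>; this is one sign and
  the square of the next factor of the double factorial.\<close>

lemma prod_eigenvalue_from_1:
  "(\<Prod>r=1..n. if 2 * r = n + 1 then 1 else of_nat n + 1 - 2 * of_nat r :: complex) =
    (-1) ^ (n div 2) * (of_nat (double_fact (n - 1)))\<^sup>2"
proof (induction n rule: double_fact.induct)
  case (3 n)
  let ?f = "\<lambda>n r. if 2 * r = n + 1 then 1 else of_nat n + 1 - 2 * of_nat r :: complex"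
  have split: "(\<Prod>r=1..Suc (Suc n). g r) = g 1 * (\<Prod>r=1..n. g (Suc r)) * g (Suc (Suc n))"
    for g :: "nat \<Rightarrow> complex"
    unfolding One_nat_def prod.atLeast1_atMost_eq prod.lessThan_Suc[of _ "Suc n"]
      prod.lessThan_Suc_shift[of _ n] by simp
  have "(\<Prod>r=1..Suc (Suc n). ?f (Suc (Suc n)) r) =
      ?f (Suc (Suc n)) 1 * (\<Prod>r=1..n. ?f (Suc (Suc n)) (Suc r)) * ?f (Suc (Suc n)) (Suc (Suc n))"
    by (rule split)
  also have "(\<Prod>r=1..n. ?f (Suc (Suc n)) (Suc r)) = (\<Prod>r=1..n. ?f n r)"
    by (intro prod.cong) auto
  also have "?f (Suc (Suc n)) 1 = of_nat n + 1" by simp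
  also have "?f (Suc (Suc n)) (Suc (Suc n)) = - (of_nat n + 1)" by simp
  also note 3
  finally have main: "(\<Prod>r=1..Suc (Suc n). ?f (Suc (Suc n)) r) = (of_nat n + 1) *
      ((-1) ^ (n div 2) * (of_nat (double_fact (n - 1)))\<^sup>2) * - (of_nat n + 1)" .
  \<comment> \<open>For \<open>n = 0\<close> the truncated \<open>n - 1\<close> is 0, and
    \<open>double_fact 0 = 1\<close> fits.\<close>
  have "double_fact (Suc (Suc n) - 1) = (n + 1) * double_fact (n - 1)"
    by (cases n) simp_all
  then show ?case unfolding main by (simp add: power_mult_distrib power2_eq_square algebra_simps)
qed simp_all

lemma prod_nonzero_eigenvalue:
  assumes "n > 1"
  shows "(\<Prod>r<n. nonzero_eigenvalue n r) =
    (-1) ^ (n div 2) * (of_nat (double_fact (n - 1)))\<^sup>2"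
proof -
  let ?f = "\<lambda>r. if 2 * r = n + 1 then 1 else of_nat n + 1 - 2 * of_nat r :: complex"
  obtain m where m: "n = Suc m" using assms by (cases n) auto
  have "(\<Prod>r<n. nonzero_eigenvalue n r) = nonzero_eigenvalue n 0 * (\<Prod>r=1..m. nonzero_eigenvalue n r)"
    unfolding m lessThan_Suc_atMost atLeast0AtMost[symmetric]
    by (simp add: prod.atLeast_Suc_atMost)
  also have "(\<Prod>r=1..m. nonzero_eigenvalue n r) = (\<Prod>r=1..m. ?f r)"
    by (intro prod.cong refl) (auto simp: nonzero_eigenvalue_def root_eigenvalue_def)
  also have "nonzero_eigenvalue n 0 = ?f n"
    using assms by (simp add: nonzero_eigenvalue_def root_eigenvalue_def)
  also have "?f n * (\<Prod>r=1..m. ?f r) = (\<Prod>r=1..n. ?f r)"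
    by (simp add: m mult.commute)
  finally show ?thesis by (simp only: prod_eigenvalue_from_1)
qed


section \<open>Diagonalisation by the Fourier matrix\<close>

definition fourier_mat :: "nat \<Rightarrow> complex \<Rightarrow> complex mat" where
  "fourier_mat n z = mat n n (\<lambda>(j, r). z ^ (j * r))"

lemma fourier_mat_carrier [simp]: "fourier_mat n z \<in> carrier_mat n n"
  by (simp add: fourier_mat_def)

lemma inverse_fourier_mat:
  assumes prim: "primitive_root_of_unity n \<zeta>"
  shows "fourier_mat n (inverse \<zeta>) * fourier_mat n \<zeta> = of_nat n \<cdot>\<^sub>m 1\<^sub>m n"
proof (rule eq_matI)
  fix j k assume "j < dim_row (of_nat n \<cdot>\<^sub>m 1\<^sub>m n :: complex mat)" "k < dim_col (of_nat n \<cdot>\<^sub>m 1\<^sub>m n :: complex mat)"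
  then have jk: "j < n" "k < n" by auto
  have "(fourier_mat n (inverse \<zeta>) * fourier_mat n \<zeta>) $$ (j, k) =
      (\<Sum>r<n. inverse \<zeta> ^ (j * r) * \<zeta> ^ (r * k))"
    using jk by (simp add: fourier_mat_def scalar_prod_def atLeast0LessThan)
  also have "\<dots> = (\<Sum>r<n. (\<zeta> ^ k * inverse \<zeta> ^ j) ^ r)"
    by (intro sum.cong refl) (simp add: power_mult_distrib mult.commute flip: power_mult)
  also have "\<dots> = (of_nat n \<cdot>\<^sub>m 1\<^sub>m n) $$ (j, k)"
    using jk by (simp add: prim_root_orthogonality[OF prim])
  finally show "(fourier_mat n (inverse \<zeta>) * fourier_mat n \<zeta>) $$ (j, k) =
      (of_nat n \<cdot>\<^sub>m 1\<^sub>m n) $$ (j, k)" .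
qed (simp_all add: fourier_mat_def)

lemma det_fourier_mat_neq_0:
  assumes "primitive_root_of_unity n \<zeta>"
  shows "det (fourier_mat n \<zeta>) \<noteq> 0"
proof -
  have "n > 0" using assms by (simp add: primitive_root_of_unity_def)
  have "det (fourier_mat n (inverse \<zeta>)) * det (fourier_mat n \<zeta>) = of_nat n ^ n"
    using arg_cong[OF inverse_fourier_mat[OF assms], of det]
    by (simp add: det_mult[of _ n])
  then show ?thesis using \<open>n > 0\<close> by auto
qed

text \<open>Multiplying the eigenvalue sum by \<open>\<zeta> ^ (j * r)\<close> shows that column
  \<open>r\<close> of the Fourier matrix is an eigenvector.\<close>

lemma root_entry_fourier:
  assumes prim: "primitive_root_of_unity n \<zeta>" and "j < n" "r < n"
  shows "(\<Sum>k<n. root_entry \<zeta> j k * \<zeta> ^ (k * r)) = \<zeta> ^ (j * r) * root_eigenvalue n r"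
proof -
  have "\<zeta> ^ (j * r) * inverse \<zeta> ^ (j * r) = 1"
    using prim_root_nonzero[OF prim] by (simp add: power_inverse)
  then have "\<zeta> ^ (j * r) * (root_entry \<zeta> j k * (\<zeta> ^ k * inverse \<zeta> ^ j) ^ r) =
      root_entry \<zeta> j k * \<zeta> ^ (k * r)" for k
    by (simp add: power_mult_distrib mult.left_commute flip: power_mult)
  then show ?thesis
    unfolding root_entry_eigenvalue[OF assms, symmetric] sum_distrib_left by (simp only:)
qed

lemma det_mat_diag: "det (mat_diag n f) = (\<Prod>i<n. f i :: 'a::comm_ring_1)"
proof -
  have "det (mat_diag n f) = prod_list (diag_mat (mat_diag n f))"
    by (rule det_upper_triangular[of _ n]) (auto simp: mat_diag_def)
  also have "diag_mat (mat_diag n f) = map f [0..<n]"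
    by (auto simp: diag_mat_def mat_diag_def)
  finally show ?thesis
    using prod.distinct_set_conv_list[of "[0..<n]" f] by (simp add: atLeast0LessThan)
qed

text \<open>The nonzero determinant of the Fourier matrix cancels; for even \<open>n\<close> no
  index satisfies \<open>2 * r = n + 1\<close>, so no eigenvalue is replaced.\<close>

lemma det_root_entry_even:
  assumes prim: "primitive_root_of_unity n \<zeta>" and n: "n > 1" "even n"
  shows "det (mat n n (\<lambda>(j, k). root_entry \<zeta> j k)) = (\<Prod>r<n. nonzero_eigenvalue n r)"
proof -
  let ?E = "mat n n (\<lambda>(j, k). root_entry \<zeta> j k)"
  have ev: "root_eigenvalue n r = nonzero_eigenvalue n r" for r
    using n(2) by (auto simp: nonzero_eigenvalue_def) presburger
  have "?E * fourier_mat n \<zeta> = fourier_mat n \<zeta> * mat_diag n (nonzero_eigenvalue n)"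
    by (rule eq_matI)
      (auto simp: mat_diag_mult_right[of _ n] fourier_mat_def scalar_prod_def atLeast0LessThan
        root_entry_fourier[OF prim] ev)
  then have "det ?E * det (fourier_mat n \<zeta>) =
      det (fourier_mat n \<zeta>) * det (mat_diag n (nonzero_eigenvalue n))"
    by (simp flip: det_mult[of _ n])
  then show ?thesis
    using det_fourier_mat_neq_0[OF prim] by (simp add: det_mat_diag)
qed

text \<open>
  With the last row of the matrix replaced by a unit vector and the result multiplied by the
  Fourier matrix, the column of the zero eigenvalue has one nonzero entry; its cofactor does not
  change when the zero eigenvalue is replaced by 1.
\<close>

lemma det_root_entry_odd:
  assumes prim: "primitive_root_of_unity n \<zeta>" and n: "n > 1" "odd n"
  shows "det (mat (n - 1) (n - 1) (\<lambda>(j, k). root_entry \<zeta> j k)) =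
    (\<Prod>r<n. nonzero_eigenvalue n r) / of_nat n"
proof -
  define r\<^sub>0 l where "r\<^sub>0 = (n + 1) div 2" and "l = n - 1"
  have r0: "2 * r\<^sub>0 = n + 1" "r\<^sub>0 < n" using n by (auto simp: r\<^sub>0_def elim: oddE)
  have l: "l < n" using n by (simp add: l_def)
  have ev0: "root_eigenvalue n r\<^sub>0 = 0"
  proof -
    have "2 * of_nat r\<^sub>0 = (of_nat n + 1 :: complex)"
      using arg_cong[OF r0(1), of "of_nat :: nat \<Rightarrow> complex"] by (simp add: add.commute)
    then show ?thesis using r0 by (simp add: root_eigenvalue_def)
  qed
  have ev: "root_eigenvalue n r = nonzero_eigenvalue n r" if "r \<noteq> r\<^sub>0" for r
    using that r0 by (auto simp: nonzero_eigenvalue_def)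
  let ?F = "fourier_mat n \<zeta>" and ?G = "fourier_mat n (inverse \<zeta>)"
  \<comment> \<open>\<open>K\<close> is the product \<open>M * ?F\<close>. It differs from
    \<open>T\<close> only in row \<open>l\<close> and column \<open>r\<^sub>0\<close>, the column of
    the zero eigenvalue. \<open>R\<close> is the inverse of \<open>T\<close>.\<close>
  define M where "M = mat n n (\<lambda>(j, k). if j = l then if k = l then 1 else 0 else root_entry \<zeta> j k)"
  define K where "K = mat n n (\<lambda>(j, r). \<zeta> ^ (j * r) * (if j = l then 1 else root_eigenvalue n r))"
  define T where "T = ?F * mat_diag n (nonzero_eigenvalue n)"
  define R where "R = mat_diag n (\<lambda>r. inverse (nonzero_eigenvalue n r)) * (inverse (of_nat n) \<cdot>\<^sub>m ?G)"
  have carrier: "M \<in> carrier_mat n n" "K \<in> carrier_mat n n" "T \<in> carrier_mat n n" "R \<in> carrier_mat n n"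
    by (auto simp: M_def K_def T_def R_def intro!: mult_carrier_mat[of _ n n])
  have T_entry: "T $$ (j, r) = \<zeta> ^ (j * r) * nonzero_eigenvalue n r" if "j < n" "r < n" for j r
    using that by (simp add: T_def mat_diag_mult_right[of _ n] fourier_mat_def)
  have det_T: "det T = det ?F * (\<Prod>r<n. nonzero_eigenvalue n r)"
    by (simp add: T_def det_mult[of _ n] det_mat_diag)
  have "M * ?F = K"
  proof (rule eq_matI)
    fix j r assume "j < dim_row K" "r < dim_col K"
    then have jr: "j < n" "r < n" by (auto simp: K_def)
    have "(M * ?F) $$ (j, r) = (\<Sum>k<n. M $$ (j, k) * \<zeta> ^ (k * r))"
      using jr by (simp add: M_def fourier_mat_def scalar_prod_def atLeast0LessThan)
    also have "\<dots> = K $$ (j, r)"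
    proof (cases "j = l")
      case True
      then have "(\<Sum>k<n. M $$ (j, k) * \<zeta> ^ (k * r)) = (\<Sum>k<n. if k = l then \<zeta> ^ (k * r) else 0)"
        using l by (intro sum.cong) (auto simp: M_def)
      then show ?thesis using jr True by (simp add: K_def)
    next
      case False
      then have "(\<Sum>k<n. M $$ (j, k) * \<zeta> ^ (k * r)) = (\<Sum>k<n. root_entry \<zeta> j k * \<zeta> ^ (k * r))"
        using jr by (intro sum.cong) (auto simp: M_def)
      then show ?thesis using jr False by (simp add: K_def root_entry_fourier[OF prim])
    qed
    finally show "(M * ?F) $$ (j, r) = K $$ (j, r)" .
  qed (simp_all add: M_def K_def fourier_mat_def)
  then have "det M * det ?F = det K"
    using det_mult[of M n ?F] carrier by simp
  moreover have "det M = det (mat (n - 1) (n - 1) (\<lambda>(j, k). root_entry \<zeta> j k))"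
  proof -
    have "det M = (\<Sum>k<n. M $$ (l, k) * cofactor M l k)"
      by (rule laplace_expansion_row[OF carrier(1) l])
    also have "\<dots> = (\<Sum>k<n. if k = l then cofactor M l k else 0)"
      using l by (intro sum.cong) (auto simp: M_def)
    also have "\<dots> = cofactor M l l" using l by simp
    also have "mat_delete M l l = mat (n - 1) (n - 1) (\<lambda>(j, k). root_entry \<zeta> j k)"
      by (rule eq_matI) (auto simp: mat_delete_def M_def l_def)
    then have "cofactor M l l = det (mat (n - 1) (n - 1) (\<lambda>(j, k). root_entry \<zeta> j k))"
      by (simp add: cofactor_def flip: mult_2)
    finally show ?thesis .
  qed
  moreover have "det K = \<zeta> ^ (l * r\<^sub>0) * cofactor T l r\<^sub>0"
  proof -
    have "det K = (\<Sum>j<n. K $$ (j, r\<^sub>0) * cofactor K j r\<^sub>0)"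
      by (rule laplace_expansion_column[OF carrier(2) r0(2)])
    also have "\<dots> = (\<Sum>j<n. if j = l then \<zeta> ^ (l * r\<^sub>0) * cofactor K l r\<^sub>0 else 0)"
      using r0 by (intro sum.cong) (auto simp: K_def ev0)
    also have "\<dots> = \<zeta> ^ (l * r\<^sub>0) * cofactor K l r\<^sub>0" using l by simp
    also have "mat_delete K l r\<^sub>0 = mat_delete T l r\<^sub>0"
      using carrier by (intro eq_matI) (auto simp: mat_delete_def K_def T_entry ev l_def)
    then have "cofactor K l r\<^sub>0 = cofactor T l r\<^sub>0" by (simp add: cofactor_def)
    finally show ?thesis .
  qed
  \<comment> \<open>The adjugate is \<open>det T\<close> times the inverse \<open>R\<close>; in row
    \<open>r\<^sub>0\<close> the scaling factor of \<open>R\<close> is 1, which leaves an entry of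
    the inverse Fourier matrix.\<close>
  moreover have "cofactor T l r\<^sub>0 = det T * (inverse \<zeta> ^ (r\<^sub>0 * l) / of_nat n)"
  proof -
    let ?D = "mat_diag n (nonzero_eigenvalue n)"
      and ?D' = "mat_diag n (\<lambda>r. inverse (nonzero_eigenvalue n r))"
      and ?G' = "inverse (of_nat n) \<cdot>\<^sub>m ?G"
    have "R * T = ?D' * (?G' * ?F * ?D)"
    proof -
      have "R * T = ?D' * (?G' * (?F * ?D))"
        unfolding R_def T_def
        by (rule assoc_mult_mat[of _ n n _ n _ n]) (auto intro!: mult_carrier_mat[of _ n n])
      also have "?G' * (?F * ?D) = ?G' * ?F * ?D"
        by (rule assoc_mult_mat[symmetric, of _ n n _ n _ n]) auto
      finally show ?thesis .
    qed
    also have "?G' * ?F = inverse (of_nat n) \<cdot>\<^sub>m (?G * ?F)"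
      by (rule mult_smult_assoc_mat[of _ n n _ n]) auto
    also have "inverse (of_nat n) \<cdot>\<^sub>m (?G * ?F) = 1\<^sub>m n"
      using n unfolding inverse_fourier_mat[OF prim] by (intro eq_matI) auto
    also have "1\<^sub>m n * ?D = ?D" by (rule left_mult_one_mat[OF mat_diag_dim])
    finally have RT: "R * T = 1\<^sub>m n"
      using nonzero_eigenvalue_neq_0[OF n(1)] by simp
    have "adj_mat T = (R * T) * adj_mat T"
      using adj_mat(1)[OF carrier(3)] by (simp add: RT)
    also have "\<dots> = R * (det T \<cdot>\<^sub>m 1\<^sub>m n)"
      using adj_mat(1,2)[OF carrier(3)] carrier by (simp add: assoc_mult_mat[of _ n n _ n _ n])
    also have "\<dots> = det T \<cdot>\<^sub>m R"
      using carrier by (simp add: mult_smult_distrib[of _ n n _ n])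
    finally have "adj_mat T $$ (r\<^sub>0, l) = (det T \<cdot>\<^sub>m R) $$ (r\<^sub>0, l)" by simp
    then show ?thesis
      using carrier r0 l
      by (simp add: adj_mat_def R_def mat_diag_mult_left[of _ n n] fourier_mat_def
          nonzero_eigenvalue_def field_simps)
  qed
  moreover have "\<zeta> ^ (l * r\<^sub>0) * inverse \<zeta> ^ (r\<^sub>0 * l) = 1"
    using prim_root_nonzero[OF prim] by (simp add: power_inverse mult.commute)
  ultimately have "det (mat (n - 1) (n - 1) (\<lambda>(j, k). root_entry \<zeta> j k)) * det ?F =
      (\<Prod>r<n. nonzero_eigenvalue n r) / of_nat n * det ?F"
    unfolding det_T using prim_root_nonzero[OF prim] by (simp add: field_simps)
  then show ?thesis
    using mult_right_cancel[OF det_fourier_mat_neq_0[OF prim]] by blast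
qed

section \<open>Permanents at roots of unity\<close>

lemma x_entry_scale: "c \<noteq> 0 \<Longrightarrow> x_entry (\<lambda>l. c * x l) j k = x_entry x j k"
  by (simp add: x_entry_def flip: distrib_left right_diff_distrib)

lemma c_entry_eq:
  assumes "\<zeta> \<noteq> 0"
  shows "c_entry \<zeta> j k = x_entry (\<lambda>l. inverse \<zeta> ^ l) j k"
proof (cases "j = k")
  case False
  have "\<zeta> powi (int j - int k) = \<zeta> ^ j / \<zeta> ^ k"
    using assms by (simp add: power_int_diff)
  moreover have "(1 + \<zeta> ^ j / \<zeta> ^ k) / (1 - \<zeta> ^ j / \<zeta> ^ k) = (\<zeta> ^ k + \<zeta> ^ j) / (\<zeta> ^ k - \<zeta> ^ j)"
    using assms by (simp add: divide_simps)
  moreover have "(inverse \<zeta> ^ j + inverse \<zeta> ^ k) / (inverse \<zeta> ^ j - inverse \<zeta> ^ k) =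
      (\<zeta> ^ k + \<zeta> ^ j) / (\<zeta> ^ k - \<zeta> ^ j)"
    using assms by (simp add: divide_simps)
  ultimately show ?thesis using False by (simp add: c_entry_def x_entry_def)
qed (simp add: c_entry_def x_entry_def)

text \<open>\<open>per_x_entry\<close> at the values \<open>inverse \<zeta> ^ l\<close>, which are
  distinct for \<open>l\<close> from 1 to \<open>n\<close>.\<close>

lemma per_c_entry:
  assumes prim: "primitive_root_of_unity n \<zeta>" and m: "2 * m \<le> n"
  shows "per (indexed_mat (2 * m) (c_entry \<zeta>)) =
    (-1) ^ m * det (mat (2 * m) (2 * m) (\<lambda>(j, k). root_entry \<zeta> j k))"
proof -
  let ?x = "\<lambda>l. inverse \<zeta> ^ l"
  have z: "\<zeta> \<noteq> 0" using prim_root_nonzero prim by blast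
  have "inj_on ?x {1..2 * m}"
  proof (rule inj_onI)
    fix a b assume ab: "a \<in> {1..2 * m}" "b \<in> {1..2 * m}" "?x a = ?x b"
    \<comment> \<open>One factor \<open>\<zeta>\<close> is split off because the exponent
      \<open>n\<close> may occur, while injectivity is known below \<open>n\<close>.\<close>
    then have "\<zeta> * \<zeta> ^ (a - 1) = \<zeta> * \<zeta> ^ (b - 1)"
      by (simp add: power_inverse flip: power_Suc)
    then have "a - 1 = b - 1"
      using ab m z by (intro inj_onD[OF prim_root_inj[OF prim]]) auto
    moreover have "a \<ge> 1" "b \<ge> 1" using ab by auto
    ultimately show "a = b" by linarith
  qed
  then have "per (indexed_mat (2 * m) (x_entry ?x)) =
      (-1) ^ m * det (indexed_mat (2 * m) (\<lambda>j k. x_entry ?x j k - 1))"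
    by (rule per_x_entry(2)) simp
  \<comment> \<open>Shifting the index of a geometric sequence rescales it, and the entries are
    homogeneous of degree 0.\<close>
  moreover have "x_entry ?x (Suc j) (Suc k) = x_entry ?x j k" for j k
    using x_entry_scale[of "inverse \<zeta>" ?x j k] z by (simp add: x_entry_Suc)
  ultimately show ?thesis
    using z by (simp add: c_entry_eq indexed_mat_def root_entry_def)
qed

theorem theorem1p3:
  shows "(\<forall>n::nat. n > 0 \<longrightarrow>
            per (indexed_mat (2 * n) (\<lambda>j k. x_entry (ratfun_var :: nat \<Rightarrow> 'a::field_char_0 ratfun) j k - 1)) =
              (-1) ^ n * det (indexed_mat (2 * n) (\<lambda>j k. x_entry (ratfun_var :: nat \<Rightarrow> 'a ratfun) j k - 1)) \<and>
            (-1) ^ n * det (indexed_mat (2 * n) (\<lambda>j k. x_entry (ratfun_var :: nat \<Rightarrow> 'a ratfun) j k - 1)) =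
              S_fun n (ratfun_var :: nat \<Rightarrow> 'a ratfun)) \<and>
         (\<forall>(n::nat) (\<zeta>::complex). n > 1 \<longrightarrow> primitive_root_of_unity n \<zeta> \<longrightarrow>
            (even n \<longrightarrow>
              per (indexed_mat n (c_entry \<zeta>)) = (of_nat (double_fact (n - 1)))\<^sup>2) \<and>
            (odd n \<longrightarrow>
              per (indexed_mat (n - 1) (c_entry \<zeta>)) = (of_nat (double_fact (n - 1)))\<^sup>2 / of_nat n))"
proof (intro conjI allI impI)
  fix n :: nat
  have "inj_on (ratfun_var :: nat \<Rightarrow> 'a ratfun) {1..2 * n}"
    by (simp add: inj_on_def ratfun_var_eq_iff)
  note part1 = per_x_entry[OF this ratfun_two_neq_0]
  show "per (indexed_mat (2 * n) (\<lambda>j k. x_entry (ratfun_var :: nat \<Rightarrow> 'a ratfun) j k - 1)) =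
      (-1) ^ n * det (indexed_mat (2 * n) (\<lambda>j k. x_entry (ratfun_var :: nat \<Rightarrow> 'a ratfun) j k - 1))"
    by (rule part1(1))
  show "(-1) ^ n * det (indexed_mat (2 * n) (\<lambda>j k. x_entry (ratfun_var :: nat \<Rightarrow> 'a ratfun) j k - 1)) =
      S_fun n (ratfun_var :: nat \<Rightarrow> 'a ratfun)"
    unfolding S_fun_def by (rule part1(2)[symmetric])
next
  fix n :: nat and \<zeta> :: complex
  assume n: "n > 1" and prim: "primitive_root_of_unity n \<zeta>"
  \<comment> \<open>One sign comes from passing from the permanent to the determinant, the other
    from the negative eigenvalues.\<close>
  have sign: "(-1) ^ (n div 2) * ((-1) ^ (n div 2) * c) = c" for c :: complex
    by (simp flip: mult.assoc power_add mult_2)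
  show "per (indexed_mat n (c_entry \<zeta>)) = (of_nat (double_fact (n - 1)))\<^sup>2" if "even n"
  proof -
    have "2 * (n div 2) = n" using that by simp
    then show ?thesis
      using per_c_entry[OF prim, of "n div 2"] det_root_entry_even[OF prim n that]
      by (simp add: prod_nonzero_eigenvalue[OF n] sign)
  qed
  show "per (indexed_mat (n - 1) (c_entry \<zeta>)) = (of_nat (double_fact (n - 1)))\<^sup>2 / of_nat n" if "odd n"
  proof -
    have "2 * (n div 2) = n - 1"
      using that by (simp add: minus_mod_eq_mult_div odd_iff_mod_2_eq_one[symmetric])
    then show ?thesis
      using per_c_entry[OF prim, of "n div 2"] det_root_entry_odd[OF prim n that]
      by (simp add: prod_nonzero_eigenvalue[OF n] sign)
  qed
qed

end
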